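(* Assume (A0''), (A1) and (A2). Then the sequence $(v^k)$ generated by the iterative algorithm is bounded.
   Context: Grid and operators. $G$ is a symmetric grid $x_{-N}=-x_N<\dots<x_{-1}=-x_1<x_0=0<x_1<\dots<x_N$ of real numbers; $\mathbb R^G$ is the set of functions $G\to\mathbb R$ (vectors), linear operators on $\mathbb R^G$ are identified with matrices in $\mathbb R^{G\times G}$, and orders, max, argmax are pointwise (elementwise). $S$ is the symmetry operator $Sv(x)=v(-x)$. $G_{<0}$ is the set of negative grid points; complements are taken in $G$. $f\in\mathbb R^G$ and $L:\mathbb R^G\to\mathbb R^G$ is linear. For each $x\in G$, $Z(x)\subseteq\mathbb R$ is a finite nonempty set, with $Z(x)=\{0\}$ if $x\ge0$; $Z=\prod_{x\in G}Z(x)$. For each $\delta\in Z$ there are given a linear $B(\delta):\mathbb R^G\to\mathbb R^G$, $c(\delta)\in(0,+\infty)^G$ and a vector $g(S\delta)\in\mathbb R^G$; these are row-decoupled: row $x$ of $B(\delta)$ and $c(\delta)$ depends only on $\delta(x)$, and entry $x$ of $g(S\delta)$ depends only on $(S\delta)(x)=\delta(-x)$. Define $Mv=\max_{\delta\in Z}\{B(\delta)v-c(\delta)\}$, $\delta^*(v)=\max(\operatorname{argmax}_{\delta\in Z}\{B(\delta)v-c(\delta)\})$ (pointwise largest maximizer) and $H(\delta)v=SB(\delta)Sv+g(S\delta)$. Strategies. $\Phi=\{\varphi=(I,\delta): I\subseteq G_{<0},\ \delta\in Z\}$. Each $I\subseteq G_{<0}$ is identified with its indicator $\psi=\mathbf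 1_I$, and $\psi$ with the diagonal matrix $\Psi=\operatorname{diag}(\psi)$ (likewise $\overline I,\overline\psi,\overline\Psi$). Algorithm (run indefinitely, with the single-player problems solved exactly). Choose $v^0\in\mathbb R^G$, set $I^0=\{Lv^0+f\le Mv^0-v^0\}\cap G_{<0}$ and $\delta^0=\delta^*(v^0)$. For $k=0,1,\dots$: let $v^{k+1/2}=H(\delta^k)v^k$ on $-I^k$ and $v^{k+1/2}=v^k$ on $(-I^k)^c$; with $D=(-I^k)^c$, let $v^{k+1}\in\mathbb R^G$ be the (unique) solution of $\max\{Lv+f,Mv-v\}=0$ on $D$ subject to $v=v^{k+1/2}$ on $D^c$; set $I^{k+1}=\{x\in D: (Lv^{k+1}+f)(x)\le\lambda(Mv^{k+1}-v^{k+1})(x)\}$ (intervention regions being understood as subsets of $G_{<0}$), where $\lambda>0$ is a fixed scaling factor, and $\delta^{k+1}=\delta^*(v^{k+1})$. Coefficients. For $\varphi=(\psi,\delta),\overline\varphi=(\overline\psi,\overline\delta)\in\Phi$: $\mathbb A(\varphi,\overline\varphi)=\operatorname{Id}-(\operatorname{Id}-\overline\Psi-S\Psi S)(\operatorname{Id}+L)-\overline\Psi B(\overline\delta)$, $\mathbb B(\varphi)=S\Psi B(\delta)S$, and $(\mathbb A-\mathbb B)(\varphi,\overline\varphi)=\mathbb A(\varphi,\overline\varphi)-\mathbb B(\varphi)$. Matrix notions. For a real square matrix $A$: row $i$ is WDD (resp. SDD) if $|A_{ii}|\ge\sum_{j\ne i}|A_{ij}|$ (resp. $>$); $A$ is WDD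 (SDD) if all rows are; $A$ is an $L_0$-matrix if its off-diagonal entries are $\le0$ and its diagonal entries are $\ge0$. graph$A$ is the directed graph on the row indices with an edge $(i,j)$ iff $A_{ij}\neq0$. $J[A]=\{i:\text{row }i\text{ of }A\text{ is SDD}\}$. Sequential index of connectivity: for a sequence $(A_k)_{k\ge1}$ of WDD matrices, consider walks $i_1\to i_2\to\dots\to i_{\ell+1}$ of length $\ell$ such that $i_k\to i_{k+1}$ is an edge of graph$A_k$ for each $k\le \ell$ and $i_{\ell+1}\in J[A_{\ell+1}]$. Then $\mathrm{con}[(A_k)]$ is the positive part of the supremum over $i_1\notin J[A_1]$ of the infimum of the lengths of such walks starting at $i_1$ ($\inf\emptyset=+\infty$, $\sup\emptyset=-\infty$). Assumptions. (A0'') There exists $m\in\mathbb N_0$ such that for any sequence of strategies $(\overline\varphi^k)\subseteq\Phi$, $\mathrm{con}\big[\big((\mathbb A-\mathbb B)(\overline\varphi^k,\overline\varphi^{k+1})\big)_k\big]\le m$. (A1) $-L$ is an SDD $L_0$-matrix and, for each $\delta\in Z$, $\operatorname{Id}-B(\delta)$ is a WDD $L_0$-matrix. (A2) $B(\delta)$ has nonnegative diagonal elements for all $\delta\in Z$.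
   Formalization: The sets I^{k+1} = {x in D: Lv+f ≤ λ(Mv−v)} are not intersected with the negative grid points but assumed contained in them (automatic when impulse 0 is null at x ≥ 0); with mere intersection and arbitrary rows of B at x ≥ 0 the claim is false. *)

theory Defs
  imports "HOL-Analysis.Analysis"
begin

text \<open>The grid \<open>G\<close> is given by a finite index type \<open>'g\<close> together with an injective
  enumeration \<open>x\<close> of the grid points by indices. Vectors in \<open>\<real>^G\<close> have type \<open>real^'g\<close>;
  linear operators are identified with their matrices.\<close>

definition symmetric_grid :: "('g::finite \<Rightarrow> real) \<Rightarrow> bool" where
  "symmetric_grid x \<longleftrightarrow> inj x \<and> 0 \<in> range x \<and> (\<forall>i. - x i \<in> range x)"

definition reflect :: "('g::finite \<Rightarrow> real) \<Rightarrow> 'g \<Rightarrow> 'g" where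
  "reflect x i = inv x (- x i)"

definition sym_op :: "('g::finite \<Rightarrow> real) \<Rightarrow> real^'g^'g" where
  "sym_op x = matrix (\<lambda>v. \<chi> i. v $ reflect x i)"

definition neg_points :: "('g::finite \<Rightarrow> real) \<Rightarrow> 'g set" where
  "neg_points x = {i. x i < 0}"

lemma x_reflect: "symmetric_grid x \<Longrightarrow> x (reflect x i) = - x i"
  unfolding symmetric_grid_def reflect_def by (simp add: f_inv_into_f)

lemma sym_op_apply:
  fixes x :: "'g::finite \<Rightarrow> real"
  shows "(sym_op x *v v) $ i = v $ reflect x i"
proof -
  have "linear (\<lambda>v::real^'g. (\<chi> i. v $ reflect x i) :: real^'g)"
    by (rule linearI) (simp_all add: vec_eq_iff)
  then show ?thesis
    unfolding sym_op_def by (simp add: matrix_works)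
qed

subsection \<open>Impulses\<close>

definition controls :: "('g::finite \<Rightarrow> real set) \<Rightarrow> (real^'g) set" where
  "controls Z = {\<delta>. \<forall>i. \<delta> $ i \<in> Z i}"

text \<open>The vector \<open>g\<close> is only used at arguments of the form \<open>S\<delta>\<close> with \<open>\<delta>\<close> in \<open>controls Z\<close>.\<close>

definition row_decoupled ::
  "('g::finite \<Rightarrow> real) \<Rightarrow> ('g \<Rightarrow> real set) \<Rightarrow> (real^'g \<Rightarrow> real^'g^'g) \<Rightarrow>
    (real^'g \<Rightarrow> real^'g) \<Rightarrow> (real^'g \<Rightarrow> real^'g) \<Rightarrow> bool" where
  "row_decoupled x Z B c g \<longleftrightarrow>
    (\<forall>\<delta>\<in>controls Z. \<forall>\<delta>'\<in>controls Z. \<forall>i.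
       (\<delta> $ i = \<delta>' $ i \<longrightarrow> B \<delta> $ i = B \<delta>' $ i \<and> c \<delta> $ i = c \<delta>' $ i) \<and>
       ((sym_op x *v \<delta>) $ i = (sym_op x *v \<delta>') $ i \<longrightarrow>
          g (sym_op x *v \<delta>) $ i = g (sym_op x *v \<delta>') $ i))"

definition max_op ::
  "('g::finite \<Rightarrow> real set) \<Rightarrow> (real^'g \<Rightarrow> real^'g^'g) \<Rightarrow> (real^'g \<Rightarrow> real^'g) \<Rightarrow>
    real^'g \<Rightarrow> real^'g" where
  "max_op Z B c v = (\<chi> i. MAX \<delta>\<in>controls Z. (B \<delta> *v v - c \<delta>) $ i)"

definition best_impulse ::
  "('g::finite \<Rightarrow> real set) \<Rightarrow> (real^'g \<Rightarrow> real^'g^'g) \<Rightarrow> (real^'g \<Rightarrow> real^'g) \<Rightarrow>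
    real^'g \<Rightarrow> real^'g" where
  "best_impulse Z B c v =
    (\<chi> i. Max {\<delta> $ i |\<delta>. \<delta> \<in> controls Z \<and> (B \<delta> *v v - c \<delta>) $ i = max_op Z B c v $ i})"

definition gain_op ::
  "('g::finite \<Rightarrow> real) \<Rightarrow> (real^'g \<Rightarrow> real^'g^'g) \<Rightarrow> (real^'g \<Rightarrow> real^'g) \<Rightarrow>
    real^'g \<Rightarrow> real^'g \<Rightarrow> real^'g" where
  "gain_op x B g \<delta> v = (sym_op x ** B \<delta> ** sym_op x) *v v + g (sym_op x *v \<delta>)"

subsection \<open>Strategies and coefficients\<close>

definition strategies ::
  "('g::finite \<Rightarrow> real) \<Rightarrow> ('g \<Rightarrow> real set) \<Rightarrow> ('g set \<times> (real^'g)) set" where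
  "strategies x Z = {I. I \<subseteq> neg_points x} \<times> controls Z"

definition indicator_diag :: "'g::finite set \<Rightarrow> real^'g^'g" where
  "indicator_diag I = (\<chi> i j. if i = j then indicator I i else 0)"

definition coeff_A ::
  "('g::finite \<Rightarrow> real) \<Rightarrow> real^'g^'g \<Rightarrow> (real^'g \<Rightarrow> real^'g^'g) \<Rightarrow>
    'g set \<times> (real^'g) \<Rightarrow> 'g set \<times> (real^'g) \<Rightarrow> real^'g^'g" where
  "coeff_A x L B \<phi> \<phi>' =
    mat 1
    - (mat 1 - indicator_diag (fst \<phi>') - sym_op x ** indicator_diag (fst \<phi>) ** sym_op x)
        ** (mat 1 + L)
    - indicator_diag (fst \<phi>') ** B (snd \<phi>')"

definition coeff_B ::
  "('g::finite \<Rightarrow> real) \<Rightarrow> (real^'g \<Rightarrow> real^'g^'g) \<Rightarrow> 'g set \<times> (real^'g) \<Rightarrow> real^'g^'g" where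
  "coeff_B x B \<phi> = sym_op x ** indicator_diag (fst \<phi>) ** B (snd \<phi>) ** sym_op x"

subsection \<open>Diagonally dominant matrices and sequential index of connectivity\<close>

definition WDD_row :: "real^'n^'n \<Rightarrow> 'n::finite \<Rightarrow> bool" where
  "WDD_row A i \<longleftrightarrow> \<bar>A $ i $ i\<bar> \<ge> (\<Sum>j\<in>UNIV - {i}. \<bar>A $ i $ j\<bar>)"

definition SDD_row :: "real^'n^'n \<Rightarrow> 'n::finite \<Rightarrow> bool" where
  "SDD_row A i \<longleftrightarrow> \<bar>A $ i $ i\<bar> > (\<Sum>j\<in>UNIV - {i}. \<bar>A $ i $ j\<bar>)"

definition WDD :: "real^'n^'n::finite \<Rightarrow> bool" where
  "WDD A \<longleftrightarrow> (\<forall>i. WDD_row A i)"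

definition SDD :: "real^'n^'n::finite \<Rightarrow> bool" where
  "SDD A \<longleftrightarrow> (\<forall>i. SDD_row A i)"

definition L0_matrix :: "real^'n^'n::finite \<Rightarrow> bool" where
  "L0_matrix A \<longleftrightarrow> (\<forall>i j. i \<noteq> j \<longrightarrow> A $ i $ j \<le> 0) \<and> (\<forall>i. A $ i $ i \<ge> 0)"

definition matrix_graph :: "real^'n^'n::finite \<Rightarrow> 'n rel" where
  "matrix_graph A = {(i, j). A $ i $ j \<noteq> 0}"

definition SDD_rows :: "real^'n^'n::finite \<Rightarrow> 'n set" where
  "SDD_rows A = {i. SDD_row A i}"

text \<open>Sequences of matrices and walks are indexed from 1; their values at 0 are irrelevant.\<close>

definition seq_walk :: "(nat \<Rightarrow> real^'n^'n::finite) \<Rightarrow> nat \<Rightarrow> (nat \<Rightarrow> 'n) \<Rightarrow> bool" where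
  "seq_walk A l w \<longleftrightarrow>
    (\<forall>k\<in>{1..l}. (w k, w (k + 1)) \<in> matrix_graph (A k)) \<and> w (l + 1) \<in> SDD_rows (A (l + 1))"

definition seq_con :: "(nat \<Rightarrow> real^'n^'n::finite) \<Rightarrow> ereal" where
  "seq_con A =
    max 0 (SUP i\<in>- SDD_rows (A 1). INF l\<in>{l. \<exists>w. w 1 = i \<and> seq_walk A l w}. ereal (real l))"

subsection \<open>The iterative algorithm\<close>

definition half_step ::
  "('g::finite \<Rightarrow> real) \<Rightarrow> (real^'g \<Rightarrow> real^'g^'g) \<Rightarrow> (real^'g \<Rightarrow> real^'g) \<Rightarrow>
    'g set \<Rightarrow> real^'g \<Rightarrow> real^'g \<Rightarrow> real^'g" where
  "half_step x B g I \<delta> v = (\<chi> i. if i \<in> reflect x ` I then gain_op x B g \<delta> v $ i else v $ i)"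

definition solves_constrained ::
  "real^'g^'g \<Rightarrow> real^'g \<Rightarrow> ('g::finite \<Rightarrow> real set) \<Rightarrow> (real^'g \<Rightarrow> real^'g^'g) \<Rightarrow>
    (real^'g \<Rightarrow> real^'g) \<Rightarrow> 'g set \<Rightarrow> real^'g \<Rightarrow> real^'g \<Rightarrow> bool" where
  "solves_constrained L f Z B c D w v \<longleftrightarrow>
    (\<forall>i\<in>D. max ((L *v v + f) $ i) ((max_op Z B c v - v) $ i) = 0) \<and>
    (\<forall>i\<in>- D. v $ i = w $ i)"

text \<open>The sequences \<open>v\<close>, \<open>I\<close>, \<open>d\<close> form a run of the algorithm with scaling factor \<open>lam\<close>.
  For \<open>k \<ge> 1\<close> the defining inequality of the intervention region is not intersected with the
  negative points. Instead, the whole set is required to consist of negative points, i.e.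
  there are no interventions at nonnegative points. This holds automatically if an impulse
  0 at a nonnegative point is the null impulse (the row of \<open>B \<delta>\<close> is that of the identity), as
  then \<open>Mv - v = - c < 0\<close> at such points.\<close>

definition algorithm_run ::
  "('g::finite \<Rightarrow> real) \<Rightarrow> real^'g^'g \<Rightarrow> real^'g \<Rightarrow> ('g \<Rightarrow> real set) \<Rightarrow>
    (real^'g \<Rightarrow> real^'g^'g) \<Rightarrow> (real^'g \<Rightarrow> real^'g) \<Rightarrow> (real^'g \<Rightarrow> real^'g) \<Rightarrow> real \<Rightarrow>
    (nat \<Rightarrow> real^'g) \<Rightarrow> (nat \<Rightarrow> 'g set) \<Rightarrow> (nat \<Rightarrow> real^'g) \<Rightarrow> bool" where
  "algorithm_run x L f Z B c g lam v I d \<longleftrightarrow>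
    I 0 = {i. (L *v v 0 + f) $ i \<le> (max_op Z B c (v 0) - v 0) $ i} \<inter> neg_points x \<and>
    (\<forall>k. d k = best_impulse Z B c (v k)) \<and>
    (\<forall>k. let D = - (reflect x ` I k) in
       solves_constrained L f Z B c D (half_step x B g (I k) (d k) (v k)) (v (Suc k)) \<and>
       I (Suc k) =
         {i\<in>D. (L *v v (Suc k) + f) $ i \<le> lam * (max_op Z B c (v (Suc k)) - v (Suc k)) $ i} \<and>
       I (Suc k) \<subseteq> neg_points x)"

subsection \<open>Assumptions\<close>

definition assumption_A0 ::
  "('g::finite \<Rightarrow> real) \<Rightarrow> real^'g^'g \<Rightarrow> ('g \<Rightarrow> real set) \<Rightarrow> (real^'g \<Rightarrow> real^'g^'g) \<Rightarrow> bool" where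
  "assumption_A0 x L Z B \<longleftrightarrow>
    (\<exists>m::nat. \<forall>\<phi>::nat \<Rightarrow> 'g set \<times> (real^'g). (\<forall>k. \<phi> k \<in> strategies x Z) \<longrightarrow>
       seq_con (\<lambda>k. coeff_A x L B (\<phi> k) (\<phi> (k + 1)) - coeff_B x B (\<phi> k)) \<le> ereal (real m))"

definition assumption_A1 ::
  "real^'g^'g \<Rightarrow> ('g::finite \<Rightarrow> real set) \<Rightarrow> (real^'g \<Rightarrow> real^'g^'g) \<Rightarrow> bool" where
  "assumption_A1 L Z B \<longleftrightarrow>
    SDD (- L) \<and> L0_matrix (- L) \<and>
    (\<forall>\<delta>\<in>controls Z. WDD (mat 1 - B \<delta>) \<and> L0_matrix (mat 1 - B \<delta>))"

definition assumption_A2 ::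
  "('g::finite \<Rightarrow> real set) \<Rightarrow> (real^'g \<Rightarrow> real^'g^'g) \<Rightarrow> bool" where
  "assumption_A2 Z B \<longleftrightarrow> (\<forall>\<delta>\<in>controls Z. \<forall>i. 0 \<le> B \<delta> $ i $ i)"

end

theory Submission imports Defs begin

text \<open>
  Why the iterates stay bounded. Off the intervention regions, the quasi-variational inequality
  gives \<open>Lv + f = 0\<close>; on \<open>I\<^sup>k\<^sup>+\<^sup>1\<close> it gives \<open>v = B(\<delta>)v - c(\<delta>)\<close> for the best impulse; on
  \<open>-I\<^sup>k\<close> the new value is the reflected intervention applied to the old iterate. Hence every
  entry of \<open>v\<^sup>k\<^sup>+\<^sup>1\<close> is a uniformly bounded constant plus a nonnegative combination, with weights
  of total mass at most 1, of entries of \<open>v\<^sup>k\<close> or of \<open>v\<^sup>k\<^sup>+\<^sup>1\<close>. Only finitely many rows of weights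
  can occur (\<open>transition_rows\<close>), since there are finitely many controls.

  If some \<open>w > 0\<close> and \<open>e > 0\<close> satisfy \<open>p w \<le> w(i) - e\<close> for every row \<open>p\<close> that can occur at \<open>i\<close>,
  then each step contracts in the norm \<open>max |v(i)| / w(i)\<close> up to a constant. It does not matter
  whether the right-hand side involves the old or the new iterate, and a bound follows by induction
  (\<open>bounded_of_strict_supersolution\<close>).

  Such a \<open>w\<close> exists as soon as every nonempty set \<open>R\<close> of grid points leaks: it contains a point at
  which every possible row either loses mass or moves some mass out of \<open>R\<close>
  (\<open>strict_supersolution_exists\<close>). One may picture a random walk whose transition rows are chosen by
  an adversary; the condition says that no set is a trap in which the adversary can
  keep the walk alive forever.

  It remains to exclude traps. The strategies met along the iteration vary from step to step, so a
  trap may use one impulse at a negative point \<open>b\<close> and another one at its mirror image \<open>-b\<close>.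
  However, the row used at \<open>-b\<close> is the reflection of a row available at \<open>b\<close>. So after enlarging the
  trap to the symmetric set \<open>R \<union> -R\<close>, a single choice of impulse at \<open>b\<close> serves both points. By
  row decoupling, these choices combine into one strategy \<open>\<phi>\<close>. For the constant sequence \<open>\<phi>\<close>, no
  walk from the trap reaches a strictly diagonally dominant row of \<open>(A - B)(\<phi>, \<phi>)\<close>,
  which contradicts the bound on the sequential index of connectivity
  (\<open>no_symmetric_trap\<close>, \<open>transition_rows_leak\<close>).
\<close>

section \<open>Substochastic rows\<close>

text \<open>The function \<open>w\<close> is built one point at a time, starting from the constant 1. Let \<open>T\<close> be the
  set of points at which \<open>w\<close> has been lowered already. The complement of \<open>T\<close> leaks at some point
  \<open>i\<close>, so there every row \<open>p\<close> has \<open>p w < 1\<close>: it either has mass below 1, or puts weight on a point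
  of \<open>T\<close>, where \<open>w < 1\<close>. As there are finitely many rows, \<open>w(i)\<close> can be lowered slightly below 1
  with the inequality at \<open>i\<close> kept strict, and lowering \<open>w(i)\<close> does no harm to the inequalities
  that hold at points of \<open>T\<close>.\<close>
lemma strict_supersolution_exists:
  fixes P :: "'a::finite \<Rightarrow> ('a \<Rightarrow> real) set"
  assumes fin: "\<And>i. finite (P i)"
    and nonneg: "\<And>i p j. p \<in> P i \<Longrightarrow> 0 \<le> p j"
    and mass: "\<And>i p. p \<in> P i \<Longrightarrow> sum p UNIV \<le> 1"
    and leak: "\<And>R. R \<noteq> {} \<Longrightarrow> \<exists>i\<in>R. \<forall>p\<in>P i. sum p UNIV < 1 \<or> (\<exists>j. j \<notin> R \<and> 0 < p j)"
  obtains w e where "e > 0" "\<And>i. 0 < w i" "\<And>i p. p \<in> P i \<Longrightarrow> (\<Sum>j\<in>UNIV. p j * w j) \<le> w i - e"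
proof -
  have "\<exists>T w. card T = n \<and> (\<forall>i. 0 < w i \<and> w i \<le> 1) \<and> (\<forall>i. i \<in> T \<longleftrightarrow> w i < 1) \<and>
      (\<forall>i\<in>T. \<forall>p\<in>P i. (\<Sum>j\<in>UNIV. p j * w j) < w i)" if "n \<le> CARD('a)" for n
    using that
  proof (induction n)
    case 0
    show ?case by (rule exI[of _ "{}"], rule exI[of _ "\<lambda>_. 1"]) simp
  next
    case (Suc n)
    then obtain T :: "'a set" and w where cT: "card T = n" and w01: "\<And>i. 0 < w i" "\<And>i. w i \<le> 1"
      and wT: "\<And>i. i \<in> T \<longleftrightarrow> w i < 1"
      and sup: "\<And>i p. i \<in> T \<Longrightarrow> p \<in> P i \<Longrightarrow> (\<Sum>j\<in>UNIV. p j * w j) < w i"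
      by (metis Suc_leD)
    have "T \<noteq> UNIV" using cT Suc.prems by auto
    then obtain i where iT: "i \<notin> T"
      and i: "\<And>p. p \<in> P i \<Longrightarrow> sum p UNIV < 1 \<or> (\<exists>j. j \<in> T \<and> 0 < p j)"
      using leak[of "- T"] by auto
    have less: "(\<Sum>j\<in>UNIV. p j * w j) < 1" if p: "p \<in> P i" for p
    proof -
      have le: "p j * w j \<le> p j" for j
        using nonneg[OF p, of j] w01(2)[of j] by (simp add: mult_left_le)
      consider "sum p UNIV < 1" | j where "j \<in> T" "0 < p j" using i[OF p] by blast
      then show ?thesis
      proof cases
        case 1
        then show ?thesis using sum_mono[of UNIV "\<lambda>j. p j * w j" p] le by fastforce
      next
        case 2
        have "(\<Sum>j\<in>UNIV. p j * w j) < sum p UNIV"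
          using 2 wT[of j] le by (intro sum_strict_mono_ex1 bexI[of _ j]) auto
        then show ?thesis using mass[OF p] by linarith
      qed
    qed
    \<comment> \<open>Half of the least gap leaves the inequality at \<open>i\<close> strict; the inserted 1 keeps the minimum
        defined when there are no rows, and the new value \<open>1 - e\<close> positive.\<close>
    define S where "S = insert 1 ((\<lambda>p. 1 - (\<Sum>j\<in>UNIV. p j * w j)) ` P i)"
    define e where "e = Min S / 2"
    have S: "finite S" "S \<noteq> {}" by (auto simp: S_def fin)
    have "\<forall>s\<in>S. 0 < s" using less by (auto simp: S_def)
    then have pos: "0 < Min S" using S by simp
    have "Min S \<le> 1" using S by (auto simp: S_def)
    then have e: "0 < e" "e < 1" using pos by (auto simp: e_def)
    have new: "(\<Sum>j\<in>UNIV. p j * w j) < 1 - e" if "p \<in> P i" for p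
    proof -
      have "Min S \<le> 1 - (\<Sum>j\<in>UNIV. p j * w j)" using S that by (intro Min_le) (auto simp: S_def)
      then show ?thesis using pos by (simp add: e_def)
    qed
    define w' where "w' = w(i := 1 - e)"
    have wi: "w i = 1" using wT[of i] iT w01(2)[of i] by simp
    have w'le: "(\<Sum>j\<in>UNIV. p j * w' j) \<le> (\<Sum>j\<in>UNIV. p j * w j)" if "p \<in> P k" for p k
    proof (intro sum_mono mult_left_mono)
      show "w' j \<le> w j" for j using wi e by (simp add: w'_def)
    qed (rule nonneg[OF that])
    show ?case
    proof (intro exI conjI ballI allI)
      show "card (insert i T) = Suc n" using cT iT by simp
      show "0 < w' k" "w' k \<le> 1" for k using w01 e by (auto simp: w'_def)
      show "k \<in> insert i T \<longleftrightarrow> w' k < 1" for k using wT e by (auto simp: w'_def)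
      show "(\<Sum>j\<in>UNIV. p j * w' j) < w' k" if "k \<in> insert i T" "p \<in> P k" for k p
      proof (cases "k = i")
        case True
        then show ?thesis using w'le[OF that(2)] new[of p] that(2) by (simp add: w'_def)
      next
        case False
        then show ?thesis using w'le[OF that(2)] sup[of k p] that by (simp add: w'_def)
      qed
    qed
  qed
  from this[OF order_refl] obtain T :: "'a set" and w
    where cT: "card T = CARD('a)" and w01: "\<And>i. 0 < w i" "\<And>i. w i \<le> 1"
      and sup: "\<And>i p. i \<in> T \<Longrightarrow> p \<in> P i \<Longrightarrow> (\<Sum>j\<in>UNIV. p j * w j) < w i"
    by metis
  have T: "T = UNIV" using cT by (simp add: card_eq_UNIV_imp_eq_UNIV)
  define S where "S = insert 1 (\<Union>i. (\<lambda>p. w i - (\<Sum>j\<in>UNIV. p j * w j)) ` P i)"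
  have S: "finite S" "S \<noteq> {}" by (auto simp: S_def fin)
  have "\<forall>s\<in>S. 0 < s" using sup T by (auto simp: S_def)
  then have pos: "0 < Min S" using S by simp
  have "(\<Sum>j\<in>UNIV. p j * w j) \<le> w i - Min S" if "p \<in> P i" for i p
  proof -
    have "Min S \<le> w i - (\<Sum>j\<in>UNIV. p j * w j)" using S that by (intro Min_le) (auto simp: S_def)
    then show ?thesis by simp
  qed
  then show ?thesis using that pos w01(1) by blast
qed

text \<open>Both the old iterate (\<open>u = v k\<close>) and the new one (\<open>u = v (Suc k)\<close>) may appear on the right
  of the recursion. The argument is therefore made at a point \<open>a\<close> where the weighted norm \<open>N\<close> of the
  new iterate is attained: if \<open>N\<close> exceeded the bound \<open>M\<close> of the old one, then \<open>N w\<close> would dominate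
  both, whence \<open>N w(a) \<le> N (w(a) - e) + C\<close>, that is \<open>N \<le> C / e \<le> M\<close>.\<close>
lemma bounded_of_strict_supersolution:
  fixes v :: "nat \<Rightarrow> real^'g::finite" and P :: "'g \<Rightarrow> ('g \<Rightarrow> real) set"
  assumes nonneg: "\<And>i p j. p \<in> P i \<Longrightarrow> 0 \<le> p j"
    and e: "e > 0" and w: "\<And>i. 0 < w i"
    and sup: "\<And>i p. p \<in> P i \<Longrightarrow> (\<Sum>j\<in>UNIV. p j * w j) \<le> w i - e"
    and step: "\<And>k i. \<exists>p\<in>P i. \<exists>u\<in>{v k, v (Suc k)}.
      \<bar>v (Suc k) $ i\<bar> \<le> (\<Sum>j\<in>UNIV. p j * \<bar>u $ j\<bar>) + C"
  shows "bounded (range v)"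
proof -
  define M where "M = Max (insert (C / e) (range (\<lambda>i. \<bar>v 0 $ i\<bar> / w i)))"
  have MC: "C / e \<le> M" by (simp add: M_def)
  have bd: "\<bar>v k $ i\<bar> \<le> M * w i" for k i
  proof (induction k arbitrary: i)
    case 0
    have "\<bar>v 0 $ i\<bar> / w i \<le> M" unfolding M_def by (rule Max_ge) auto
    then show ?case using w[of i] by (simp add: field_simps)
  next
    case (Suc k)
    define N where "N = Max (range (\<lambda>i. \<bar>v (Suc k) $ i\<bar> / w i))"
    have "N \<in> range (\<lambda>i. \<bar>v (Suc k) $ i\<bar> / w i)" unfolding N_def by (rule Max_in) auto
    then obtain a where a: "N = \<bar>v (Suc k) $ a\<bar> / w a" by blast
    have N: "\<bar>v (Suc k) $ j\<bar> \<le> N * w j" for j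
    proof -
      have "\<bar>v (Suc k) $ j\<bar> / w j \<le> N" unfolding N_def by (rule Max_ge) auto
      then show ?thesis using w[of j] by (simp add: field_simps)
    qed
    have "N \<le> M"
    proof (rule ccontr)
      assume "\<not> N \<le> M"
      then have MN: "M < N" by simp
      have N0: "0 \<le> N" using w[of a] by (simp add: a)
      obtain p u where p: "p \<in> P a" and u: "u \<in> {v k, v (Suc k)}"
        and le: "\<bar>v (Suc k) $ a\<bar> \<le> (\<Sum>j\<in>UNIV. p j * \<bar>u $ j\<bar>) + C"
        using step by blast
      have "\<bar>u $ j\<bar> \<le> N * w j" for j
        using u N[of j] order_trans[OF Suc.IH[of j] mult_right_mono[of M N "w j"]] MN w[of j]
        by auto
      then have "(\<Sum>j\<in>UNIV. p j * \<bar>u $ j\<bar>) \<le> (\<Sum>j\<in>UNIV. p j * (N * w j))"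
        using nonneg[OF p] by (intro sum_mono mult_left_mono) auto
      also have "\<dots> = N * (\<Sum>j\<in>UNIV. p j * w j)"
        by (simp add: sum_distrib_left mult_ac)
      also have "\<dots> \<le> N * (w a - e)" using sup[OF p] N0 by (rule mult_left_mono)
      finally have "N * w a \<le> N * (w a - e) + C" using le w[of a] by (simp add: a)
      then have "N \<le> C / e" using e by (simp add: field_simps)
      then show False using MN MC by simp
    qed
    then show ?case using N[of i] mult_right_mono[of N M "w i"] w[of i] by linarith
  qed
  have "norm (v k) \<le> (\<Sum>i\<in>UNIV. M * w i)" for k
    by (rule order_trans[OF norm_le_l1_cart]) (intro sum_mono bd)
  then show ?thesis by (intro boundedI[of _ "\<Sum>i\<in>UNIV. M * w i"]) auto
qed

section \<open>Reflection of the grid\<close>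

lemma reflect_involution: "symmetric_grid x \<Longrightarrow> reflect x (reflect x i) = i"
  by (metis reflect_def symmetric_grid_def x_reflect add.inverse_inverse inv_f_f)

lemma bij_reflect: "symmetric_grid x \<Longrightarrow> bij (reflect x)"
  by (rule involuntory_imp_bij) (simp add: reflect_involution)

lemma sum_reflect: "symmetric_grid x \<Longrightarrow> (\<Sum>j\<in>UNIV. h (reflect x j)) = (\<Sum>j\<in>UNIV. h j)"
  using sum.reindex_bij_betw[OF bij_reflect] .

lemma sym_op_entry: "sym_op x $ i $ j = (if reflect x i = j then 1 else 0)"
  by (simp add: sym_op_def matrix_def axis_def)

lemma sym_op_mult_left: "(sym_op x ** A) $ i $ j = A $ reflect x i $ j"
  by (simp add: matrix_matrix_mult_def sym_op_entry if_distrib[of "\<lambda>z. z * _"] cong: if_cong)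

lemma sym_op_mult_right:
  assumes "symmetric_grid x"
  shows "(A ** sym_op x) $ i $ j = A $ i $ reflect x j"
proof -
  have "(A ** sym_op x) $ i $ j = (\<Sum>k\<in>UNIV. A $ i $ k * (if k = reflect x j then 1 else 0))"
    using reflect_involution[OF assms]
    by (auto simp: matrix_matrix_mult_def sym_op_entry intro!: sum.cong)
  then show ?thesis by (simp add: if_distrib cong: if_cong)
qed

lemma indicator_diag_mult_left:
  "(indicator_diag I ** A) $ i $ j = indicator I i * A $ i $ j"
  by (simp add: matrix_matrix_mult_def indicator_diag_def if_distrib[of "\<lambda>z. z * _"] cong: if_cong)

lemma gain_op_apply:
  assumes "symmetric_grid x"
  shows "gain_op x B g \<delta> u $ i =
    (\<Sum>j\<in>UNIV. B \<delta> $ reflect x i $ reflect x j * u $ j) + g (sym_op x *v \<delta>) $ i"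
  by (simp add: gain_op_def matrix_vector_mult_def sym_op_mult_right[OF assms] sym_op_mult_left)

text \<open>The factor in front of \<open>Id + L\<close> is diagonal, as \<open>S diag(1\<^sub>I) S\<close> is the diagonal matrix of the
  indicator of \<open>-I\<close>.\<close>
lemma diagonal_factor_entry:
  fixes x :: "'g::finite \<Rightarrow> real"
  assumes "symmetric_grid x"
  shows "((mat 1 - indicator_diag J - sym_op x ** indicator_diag I ** sym_op x) ** A) $ i $ j =
    (1 - indicator J i - indicator I (reflect x i)) * A $ i $ j"
proof -
  have "sym_op x ** indicator_diag I ** sym_op x = indicator_diag (reflect x -` I)"
    using injD[OF bij_is_inj[OF bij_reflect[OF assms]]]
    by (auto simp: vec_eq_iff sym_op_mult_right[OF assms] sym_op_mult_left indicator_diag_def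
        indicator_def)
  then show ?thesis
    by (simp add: matrix_matrix_mult_def mat_def indicator_diag_def left_diff_distrib
        sum_subtractf if_distrib[of "\<lambda>z. z * _"] indicator_def cong: if_cong)
qed

lemma coefficient_entry:
  assumes "symmetric_grid x"
  shows "(coeff_A x L B (I, \<delta>) (I', \<delta>') - coeff_B x B (I, \<delta>)) $ i $ j =
    (mat 1 :: real^'g^'g) $ i $ j
    - (1 - indicator I' i - indicator I (reflect x i)) * (mat 1 + L) $ i $ j
    - indicator I' i * B \<delta>' $ i $ j
    - indicator I (reflect x i) * B \<delta> $ reflect x i $ reflect x j"
proof -
  have "coeff_B x B (I, \<delta>) $ i $ j =
      indicator I (reflect x i) * B \<delta> $ reflect x i $ reflect x j"
    unfolding coeff_B_def
    by (simp add: sym_op_mult_right[OF assms] matrix_mul_assoc[symmetric] sym_op_mult_left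
        indicator_diag_mult_left)
  then show ?thesis
    unfolding coeff_A_def
    by (simp only: vector_minus_component fst_conv snd_conv diagonal_factor_entry[OF assms]
        indicator_diag_mult_left)
qed

section \<open>Intervention rows\<close>

lemma intervention_row_nonneg:
  assumes "assumption_A1 L Z B" "assumption_A2 Z B" "\<delta> \<in> controls Z"
  shows "0 \<le> B \<delta> $ i $ j"
proof (cases "i = j")
  case False
  then have "(mat 1 - B \<delta>) $ i $ j \<le> 0"
    using assms by (auto simp: assumption_A1_def L0_matrix_def)
  then show ?thesis using False by (simp add: mat_def)
qed (use assms in \<open>auto simp: assumption_A2_def\<close>)

lemma intervention_row_mass:
  assumes "assumption_A1 L Z B" "assumption_A2 Z B" "\<delta> \<in> controls Z"
  shows "(\<Sum>j\<in>UNIV. B \<delta> $ i $ j) \<le> 1"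
proof -
  have "WDD_row (mat 1 - B \<delta>) i" "0 \<le> (mat 1 - B \<delta>) $ i $ i"
    using assms by (auto simp: assumption_A1_def WDD_def L0_matrix_def)
  moreover have "(\<Sum>j\<in>UNIV - {i}. \<bar>(mat 1 - B \<delta>) $ i $ j\<bar>) = (\<Sum>j\<in>UNIV - {i}. B \<delta> $ i $ j)"
    using intervention_row_nonneg[OF assms, of i] by (intro sum.cong) (auto simp: mat_def)
  ultimately show ?thesis
    by (simp add: WDD_row_def mat_def sum.remove[of UNIV i])
qed

text \<open>A row of \<open>Id - Q\<close> with \<open>Q\<close> nonnegative of full mass satisfies
  the dominance condition with equality.\<close>
lemma not_SDD_row_of_full_mass:
  assumes "\<And>j. A $ i $ j = (if i = j then 1 else 0) - q j" "\<And>j. 0 \<le> q j" "sum q UNIV = (1::real)"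
  shows "\<not> SDD_row A i"
proof -
  have eq: "(\<Sum>j\<in>UNIV - {i}. \<bar>A $ i $ j\<bar>) = sum q (UNIV - {i})"
    using assms by (intro sum.cong) auto
  have "1 = q i + sum q (UNIV - {i})" using assms(3) by (simp add: sum.remove[of UNIV i])
  moreover have "0 \<le> sum q (UNIV - {i})" using assms by (intro sum_nonneg)
  ultimately show ?thesis unfolding SDD_row_def eq using assms(1)[of i] by simp
qed

text \<open>The infimum over no walks is \<open>\<infinity>\<close>, so a finite index forces a walk to exist.\<close>
lemma seq_con_walk:
  assumes "seq_con A \<le> ereal r" "i \<notin> SDD_rows (A 1)"
  obtains l w where "w 1 = i" "seq_walk A l w"
proof -
  define F where "F i = (INF l\<in>{l. \<exists>w. w 1 = i \<and> seq_walk A l w}. ereal (real l))" for i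
  have "F i \<le> (SUP i\<in>- SDD_rows (A 1). F i)" using assms(2) by (intro SUP_upper) simp
  also have "\<dots> \<le> seq_con A" by (simp add: seq_con_def F_def)
  finally have "F i \<le> ereal r" using assms(1) by simp
  then have "F i \<noteq> top" by (auto simp: top_ereal_def)
  then have "{l. \<exists>w. w 1 = i \<and> seq_walk A l w} \<noteq> {}"
    unfolding F_def by (metis (no_types, lifting) INF_empty)
  then show ?thesis using that by blast
qed

text \<open>Here \<open>J\<close> is the negative half of a symmetric trap \<open>R = J \<union> -J\<close>. The impulses that keep each
  point of \<open>J\<close> inside the trap are glued to one control \<open>\<delta>\<close>. With the strategy \<open>(J, \<delta>)\<close>, the
  intervention rows sit exactly at the points of \<open>R\<close>: those at \<open>J\<close> come from \<open>Id - B(\<delta>)\<close> and those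
  at \<open>-J\<close> from its reflection. They have full mass and no edge leaving \<open>R\<close>, so a walk that starts in
  \<open>R\<close> never meets a strictly diagonally dominant row.\<close>
lemma no_symmetric_trap:
  fixes x :: "'g::finite \<Rightarrow> real"
  assumes grid: "symmetric_grid x" and ne: "controls Z \<noteq> {}"
    and dec: "row_decoupled x Z B c g" and A0: "assumption_A0 x L Z B"
    and A1: "assumption_A1 L Z B" and A2: "assumption_A2 Z B"
    and J: "J \<subseteq> neg_points x" "J \<noteq> {}"
    and trap: "\<And>b. b \<in> J \<Longrightarrow> \<exists>\<delta>\<in>controls Z. (\<Sum>j\<in>UNIV. B \<delta> $ b $ j) = 1 \<and>
        (\<forall>j. B \<delta> $ b $ j \<noteq> 0 \<longrightarrow> j \<in> J \<or> reflect x j \<in> J)"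
  shows False
proof -
  obtain D where D: "\<And>b. b \<in> J \<Longrightarrow> D b \<in> controls Z \<and> (\<Sum>j\<in>UNIV. B (D b) $ b $ j) = 1 \<and>
        (\<forall>j. B (D b) $ b $ j \<noteq> 0 \<longrightarrow> j \<in> J \<or> reflect x j \<in> J)"
    using trap by metis
  obtain \<delta>0 where \<delta>0: "\<delta>0 \<in> controls Z" using ne by blast
  define \<delta> :: "real^'g" where "\<delta> = (\<chi> b. if b \<in> J then D b $ b else \<delta>0 $ b)"
  have \<delta>: "\<delta> \<in> controls Z" using D \<delta>0 by (auto simp: \<delta>_def controls_def)
  have row: "B \<delta> $ b = B (D b) $ b" if "b \<in> J" for b
  proof -
    have "D b \<in> controls Z" "\<delta> $ b = D b $ b" using D[OF that] that by (auto simp: \<delta>_def)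
    then show ?thesis using dec \<delta> unfolding row_decoupled_def by blast
  qed
  define A where "A = coeff_A x L B (J, \<delta>) (J, \<delta>) - coeff_B x B (J, \<delta>)"
  have disj: "reflect x b \<notin> J" if "b \<in> J" for b
  proof -
    have "\<not> x (reflect x b) < 0" using that J(1) x_reflect[OF grid, of b] by (auto simp: neg_points_def)
    then show ?thesis using J(1) by (auto simp: neg_points_def)
  qed
  have A_neg: "A $ b $ j = (if b = j then 1 else 0) - B \<delta> $ b $ j" if "b \<in> J" for b j
    unfolding A_def coefficient_entry[OF grid] using that disj[OF that] by (simp add: mat_def)
  have A_pos: "A $ b $ j = (if b = j then 1 else 0) - B \<delta> $ reflect x b $ reflect x j"
    if "reflect x b \<in> J" for b j
    unfolding A_def coefficient_entry[OF grid]
    using that disj[OF that] by (simp add: mat_def reflect_involution[OF grid])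
  define R where "R = {i. i \<in> J \<or> reflect x i \<in> J}"
  have R_notSDD: "i \<notin> SDD_rows A" if "i \<in> R" for i
  proof -
    have "\<not> SDD_row A i"
    proof (cases "i \<in> J")
      case True
      show ?thesis
        using D[OF True] row[OF True]
        by (intro not_SDD_row_of_full_mass[OF A_neg[OF True]] intervention_row_nonneg[OF A1 A2 \<delta>])
          simp
    next
      case False
      then have i: "reflect x i \<in> J" using that by (simp add: R_def)
      show ?thesis
        using D[OF i] row[OF i] sum_reflect[OF grid, of "\<lambda>j. B \<delta> $ reflect x i $ j"]
        by (intro not_SDD_row_of_full_mass[OF A_pos[OF i]] intervention_row_nonneg[OF A1 A2 \<delta>])
          simp
    qed
    then show ?thesis by (simp add: SDD_rows_def)
  qed
  have R_closed: "j \<in> R" if "i \<in> R" "A $ i $ j \<noteq> 0" for i j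
  proof (cases "i = j")
    case False
    show ?thesis
    proof (cases "i \<in> J")
      case True
      then show ?thesis using D[OF True] row[OF True] A_neg[OF True, of j] that False
        by (auto simp: R_def)
    next
      case iJ: False
      then have i: "reflect x i \<in> J" using that by (simp add: R_def)
      then show ?thesis using D[OF i] row[OF i] A_pos[OF i, of j] that False
        by (auto simp: R_def reflect_involution[OF grid])
    qed
  qed (use that in simp)
  obtain m :: nat where "\<forall>\<phi>::nat \<Rightarrow> 'g set \<times> (real^'g). (\<forall>k. \<phi> k \<in> strategies x Z) \<longrightarrow>
       seq_con (\<lambda>k. coeff_A x L B (\<phi> k) (\<phi> (k + 1)) - coeff_B x B (\<phi> k)) \<le> ereal (real m)"
    using A0 unfolding assumption_A0_def by blast
  from this[rule_format, of "\<lambda>_. (J, \<delta>)"] have con: "seq_con (\<lambda>_. A) \<le> ereal (real m)"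
    using J(1) \<delta> by (simp add: strategies_def A_def)
  obtain b where b: "b \<in> J" using J(2) by blast
  then have "b \<notin> SDD_rows A" by (intro R_notSDD) (simp add: R_def)
  then obtain l u where u: "u 1 = b" "seq_walk (\<lambda>_. A) l u" using seq_con_walk[OF con] by metis
  have "n \<le> l \<Longrightarrow> u (n + 1) \<in> R" for n
  proof (induction n)
    case (Suc n)
    then show ?case using u(2) R_closed[of "u (n + 1)" "u (Suc n + 1)"]
      by (auto simp: seq_walk_def matrix_graph_def dest!: bspec[of _ _ "Suc n"])
  qed (use u b in \<open>simp add: R_def\<close>)
  then show False using R_notSDD u(2) by (auto simp: seq_walk_def)
qed

section \<open>All rows of the iteration\<close>

text \<open>Row \<open>i\<close> of the Jacobi iteration for \<open>Lv + f = 0\<close>, which solves the equation at \<open>i\<close> for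
  \<open>v(i)\<close>.\<close>
definition diffusion_row :: "real^'g^'g \<Rightarrow> 'g::finite \<Rightarrow> 'g \<Rightarrow> real" where
  "diffusion_row L i j = (if j = i then 0 else L $ i $ j / (- L $ i $ i))"

text \<open>Every row of weights that any strategy can produce at \<open>i\<close>, be it through the old or the new
  iterate.\<close>
definition transition_rows ::
  "('g::finite \<Rightarrow> real) \<Rightarrow> real^'g^'g \<Rightarrow> ('g \<Rightarrow> real set) \<Rightarrow> (real^'g \<Rightarrow> real^'g^'g) \<Rightarrow>
    'g \<Rightarrow> ('g \<Rightarrow> real) set" where
  "transition_rows x L Z B i =
    insert (diffusion_row L i)
      ((if x i < 0 then (\<lambda>\<delta> j. B \<delta> $ i $ j) ` controls Z else {}) \<union>
       (if 0 < x i then (\<lambda>\<delta> j. B \<delta> $ reflect x i $ reflect x j) ` controls Z else {}))"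

lemma finite_controls:
  assumes "\<And>i. finite (Z i)"
  shows "finite (controls Z)"
proof (rule finite_subset)
  show "controls Z \<subseteq> vec_lambda ` (\<Pi>\<^sub>E i\<in>UNIV. Z i)"
  proof
    fix \<delta> assume "\<delta> \<in> controls Z"
    then have "vec_nth \<delta> \<in> (\<Pi>\<^sub>E i\<in>UNIV. Z i)" by (auto simp: controls_def)
    then have "vec_lambda (vec_nth \<delta>) \<in> vec_lambda ` (\<Pi>\<^sub>E i\<in>UNIV. Z i)" by (rule imageI)
    then show "\<delta> \<in> vec_lambda ` (\<Pi>\<^sub>E i\<in>UNIV. Z i)" by simp
  qed
  show "finite (vec_lambda ` (\<Pi>\<^sub>E i\<in>UNIV. Z i))"
    by (intro finite_imageI finite_PiE assms) simp
qed

lemma controls_nonempty: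
  assumes "\<And>i. Z i \<noteq> {}"
  shows "controls Z \<noteq> {}"
proof -
  have "(\<chi> i. SOME z. z \<in> Z i) \<in> controls Z"
    using assms by (simp add: controls_def some_in_eq)
  then show ?thesis by blast
qed

text \<open>Strict diagonal dominance of \<open>-L\<close> becomes strict loss of mass, so diffusion rows never belong
  to a trap.\<close>
lemma diffusion_row_facts:
  assumes "assumption_A1 L Z B"
  shows "L $ i $ i < 0" "0 \<le> diffusion_row L i j" "sum (diffusion_row L i) UNIV < 1"
proof -
  have sdd: "SDD_row (- L) i" and off: "\<And>j. i \<noteq> j \<Longrightarrow> 0 \<le> L $ i $ j" and di: "L $ i $ i \<le> 0"
    using assms by (auto simp: assumption_A1_def SDD_def L0_matrix_def)
  have eq: "(\<Sum>j\<in>UNIV - {i}. \<bar>(- L) $ i $ j\<bar>) = (\<Sum>j\<in>UNIV - {i}. L $ i $ j)"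
    using off by (intro sum.cong) auto
  have lt: "(\<Sum>j\<in>UNIV - {i}. L $ i $ j) < - L $ i $ i"
    using sdd di unfolding SDD_row_def eq by simp
  moreover have "0 \<le> (\<Sum>j\<in>UNIV - {i}. L $ i $ j)" using off by (intro sum_nonneg) auto
  ultimately show neg: "L $ i $ i < 0" by linarith
  show "0 \<le> diffusion_row L i j"
    using neg off[of j] by (auto simp: diffusion_row_def divide_simps)
  have "sum (diffusion_row L i) UNIV = (\<Sum>j\<in>UNIV - {i}. diffusion_row L i j)"
    by (simp add: sum.remove[of UNIV i] diffusion_row_def)
  also have "\<dots> = (\<Sum>j\<in>UNIV - {i}. L $ i $ j / (- L $ i $ i))"
    by (intro sum.cong) (auto simp: diffusion_row_def)
  also have "\<dots> = (\<Sum>j\<in>UNIV - {i}. L $ i $ j) / (- L $ i $ i)"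
    by (simp only: sum_divide_distrib)
  also have "\<dots> < 1" using lt neg by (simp add: divide_simps)
  finally show "sum (diffusion_row L i) UNIV < 1" .
qed

lemma transition_rows_substochastic:
  assumes "symmetric_grid x" "assumption_A1 L Z B" "assumption_A2 Z B" "p \<in> transition_rows x L Z B i"
  shows "0 \<le> p j" "sum p UNIV \<le> 1"
proof -
  show "0 \<le> p j"
    using assms(4) intervention_row_nonneg[OF assms(2,3)] diffusion_row_facts(2)[OF assms(2)]
    by (auto simp: transition_rows_def split: if_splits)
  show "sum p UNIV \<le> 1"
    using assms(4) intervention_row_mass[OF assms(2,3)]
      less_imp_le[OF diffusion_row_facts(3)[OF assms(2)]]
    by (auto simp: transition_rows_def sum_reflect[OF assms(1), of "\<lambda>j. B _ $ _ $ j"]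
        split: if_splits)
qed

text \<open>A set \<open>R\<close> that does not leak has, at each of its points, a row of full mass supported in \<open>R\<close>.
  This cannot be a diffusion row, so \<open>0 \<notin> R\<close> and the row is an intervention row or the reflection of
  one. A point and its mirror image may have come with different impulses; for each \<open>b\<close> in the
  negative half of \<open>R \<union> -R\<close>, one that works at \<open>b\<close> or, reflected, at \<open>-b\<close> is enough for a
  symmetric trap.\<close>
lemma transition_rows_leak:
  fixes x :: "'g::finite \<Rightarrow> real"
  assumes grid: "symmetric_grid x" and ne: "controls Z \<noteq> {}"
    and dec: "row_decoupled x Z B c g" and A0: "assumption_A0 x L Z B"
    and A1: "assumption_A1 L Z B" and A2: "assumption_A2 Z B"
    and R: "R \<noteq> {}"
  shows "\<exists>i\<in>R. \<forall>p\<in>transition_rows x L Z B i. sum p UNIV < 1 \<or> (\<exists>j. j \<notin> R \<and> 0 < p j)"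
proof (rule ccontr)
  assume "\<not> ?thesis"
  then have bad: "\<exists>p\<in>transition_rows x L Z B i. 1 \<le> sum p UNIV \<and> (\<forall>j. 0 < p j \<longrightarrow> j \<in> R)"
    if "i \<in> R" for i using that by (meson not_le)
  define J where "J = {b. x b < 0 \<and> (b \<in> R \<or> reflect x b \<in> R)}"
  have neg: "\<exists>\<delta>\<in>controls Z. (\<Sum>j\<in>UNIV. B \<delta> $ i $ j) = 1 \<and> (\<forall>j. B \<delta> $ i $ j \<noteq> 0 \<longrightarrow> j \<in> R)"
    if i: "i \<in> R" "x i < 0" for i
  proof -
    obtain p where p: "p \<in> transition_rows x L Z B i" "1 \<le> sum p UNIV" "\<And>j. 0 < p j \<Longrightarrow> j \<in> R"
      using bad[OF i(1)] by blast
    then obtain \<delta> where \<delta>: "\<delta> \<in> controls Z" "p = (\<lambda>j. B \<delta> $ i $ j)"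
      using i(2) diffusion_row_facts(3)[OF A1, of i] by (auto simp: transition_rows_def)
    then show ?thesis
      using p(2,3) intervention_row_mass[OF A1 A2 \<delta>(1), of i]
        intervention_row_nonneg[OF A1 A2 \<delta>(1), of i]
      by (intro bexI[of _ \<delta>]) (auto simp: order_less_le)
  qed
  have pos: "\<exists>\<delta>\<in>controls Z. (\<Sum>j\<in>UNIV. B \<delta> $ reflect x i $ j) = 1 \<and>
      (\<forall>j. B \<delta> $ reflect x i $ j \<noteq> 0 \<longrightarrow> reflect x j \<in> R)"
    if i: "i \<in> R" "0 < x i" for i
  proof -
    obtain p where p: "p \<in> transition_rows x L Z B i" "1 \<le> sum p UNIV" "\<And>j. 0 < p j \<Longrightarrow> j \<in> R"
      using bad[OF i(1)] by blast
    then obtain \<delta> where \<delta>: "\<delta> \<in> controls Z" "p = (\<lambda>j. B \<delta> $ reflect x i $ reflect x j)"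
      using i(2) diffusion_row_facts(3)[OF A1, of i] by (auto simp: transition_rows_def)
    have "(\<Sum>j\<in>UNIV. B \<delta> $ reflect x i $ j) = 1"
      using p(2) intervention_row_mass[OF A1 A2 \<delta>(1), of "reflect x i"]
      by (simp add: \<delta>(2) sum_reflect[OF grid, of "\<lambda>j. B \<delta> $ reflect x i $ j"])
    moreover have "reflect x j \<in> R" if "B \<delta> $ reflect x i $ j \<noteq> 0" for j
      using p(3)[of "reflect x j"] that intervention_row_nonneg[OF A1 A2 \<delta>(1), of "reflect x i" j]
      by (simp add: \<delta>(2) reflect_involution[OF grid] order_less_le)
    ultimately show ?thesis using \<delta>(1) by blast
  qed
  have not0: "x i \<noteq> 0" if "i \<in> R" for i
    using bad[OF that] diffusion_row_facts(3)[OF A1, of i]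
    by (fastforce simp: transition_rows_def)
  have RJ: "i \<in> J \<or> reflect x i \<in> J" if "i \<in> R \<or> reflect x i \<in> R" for i
  proof -
    have "x i \<noteq> 0" using that not0[of i] not0[of "reflect x i"] x_reflect[OF grid, of i] by auto
    then show ?thesis
      using that x_reflect[OF grid, of i] by (auto simp: J_def reflect_involution[OF grid])
  qed
  show False
  proof (rule no_symmetric_trap[OF grid ne dec A0 A1 A2, of J])
    show "J \<subseteq> neg_points x" by (auto simp: J_def neg_points_def)
    show "J \<noteq> {}" using R RJ by blast
    fix b assume b: "b \<in> J"
    then consider "b \<in> R" "x b < 0" | "reflect x b \<in> R" "x b < 0" by (auto simp: J_def)
    then show "\<exists>\<delta>\<in>controls Z. (\<Sum>j\<in>UNIV. B \<delta> $ b $ j) = 1 \<and>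
        (\<forall>j. B \<delta> $ b $ j \<noteq> 0 \<longrightarrow> j \<in> J \<or> reflect x j \<in> J)"
    proof cases
      case 1
      then show ?thesis using neg[OF 1] RJ by blast
    next
      case 2
      then show ?thesis
        using pos[OF 2(1)] x_reflect[OF grid, of b] RJ reflect_involution[OF grid, of b] by force
    qed
  qed
qed

section \<open>The algorithm\<close>

text \<open>The best impulse is assembled from separate maximizers for each row. Row decoupling makes
  the assembled control optimal in all rows at once.\<close>
lemma best_impulse_attains:
  assumes fin: "\<And>i. finite (Z i)" and ne: "\<And>i. Z i \<noteq> {}" and dec: "row_decoupled x Z B c g"
  shows "best_impulse Z B c u \<in> controls Z"
    and "max_op Z B c u $ i =
      (B (best_impulse Z B c u) *v u) $ i - c (best_impulse Z B c u) $ i"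
proof -
  define d where "d = best_impulse Z B c u"
  have ex: "\<exists>\<delta>\<in>controls Z. \<delta> $ i = d $ i \<and> (B \<delta> *v u - c \<delta>) $ i = max_op Z B c u $ i" for i
  proof -
    define X where "X = {\<delta> \<in> controls Z. (B \<delta> *v u - c \<delta>) $ i = max_op Z B c u $ i}"
    have "(MAX \<delta>\<in>controls Z. (B \<delta> *v u - c \<delta>) $ i) \<in> (\<lambda>\<delta>. (B \<delta> *v u - c \<delta>) $ i) ` controls Z"
      using finite_controls[of Z] fin controls_nonempty[of Z] ne by (intro Max_in) auto
    then have "X \<noteq> {}" by (auto simp: X_def max_op_def)
    moreover have "finite X" using finite_controls[of Z] fin by (simp add: X_def)
    ultimately have "Max ((\<lambda>\<delta>. \<delta> $ i) ` X) \<in> (\<lambda>\<delta>. \<delta> $ i) ` X" by (intro Max_in) auto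
    moreover have "d $ i = Max ((\<lambda>\<delta>. \<delta> $ i) ` X)"
      by (auto simp: d_def best_impulse_def X_def image_def intro!: arg_cong[where f = Max])
    ultimately show ?thesis by (auto simp: X_def)
  qed
  show dZ: "best_impulse Z B c u \<in> controls Z"
    using ex unfolding controls_def d_def[symmetric] by (smt (verit) mem_Collect_eq)
  obtain \<delta> where \<delta>: "\<delta> \<in> controls Z" "\<delta> $ i = d $ i" "(B \<delta> *v u - c \<delta>) $ i = max_op Z B c u $ i"
    using ex by blast
  have "B \<delta> $ i = B d $ i" "c \<delta> $ i = c d $ i"
    using dec \<delta>(1,2) dZ unfolding row_decoupled_def d_def[symmetric] by blast+
  then show "max_op Z B c u $ i =
      (B (best_impulse Z B c u) *v u) $ i - c (best_impulse Z B c u) $ i"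
    using \<delta>(3) unfolding d_def[symmetric] by (simp add: matrix_vector_mult_def)
qed

lemma abs_row_bound:
  fixes p :: "'g::finite \<Rightarrow> real" and u :: "real^'g"
  assumes "\<And>j. 0 \<le> p j"
  shows "\<bar>\<Sum>j\<in>UNIV. p j * u $ j\<bar> \<le> (\<Sum>j\<in>UNIV. p j * \<bar>u $ j\<bar>)"
  using sum_abs[of "\<lambda>j. p j * u $ j" UNIV] assms by (simp add: abs_mult)

lemma diffusion_row_solution:
  assumes "assumption_A1 L Z B" "(L *v u + f) $ i = 0"
  shows "u $ i = (\<Sum>j\<in>UNIV. diffusion_row L i j * u $ j) + f $ i / (- L $ i $ i)"
proof -
  have "(\<Sum>j\<in>UNIV. diffusion_row L i j * u $ j) =
      (\<Sum>j\<in>UNIV - {i}. L $ i $ j / (- L $ i $ i) * u $ j)"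
    by (auto simp: sum.remove[of UNIV i] diffusion_row_def intro!: sum.cong)
  also have "\<dots> = (\<Sum>j\<in>UNIV - {i}. L $ i $ j * u $ j) / (- L $ i $ i)"
    unfolding sum_divide_distrib by (intro sum.cong) (auto simp: divide_simps)
  moreover have "L $ i $ i * u $ i + (\<Sum>j\<in>UNIV - {i}. L $ i $ j * u $ j) + f $ i = 0"
    using assms(2) by (simp add: matrix_vector_mult_def sum.remove[of UNIV i])
  ultimately show ?thesis
    using diffusion_row_facts(1)[OF assms(1), of i] by (simp add: field_simps)
qed

theorem proposition2p5p6:
  fixes x :: "'g::finite \<Rightarrow> real"
    and L :: "real^'g^'g" and f :: "real^'g"
    and Z :: "'g \<Rightarrow> real set"
    and B :: "real^'g \<Rightarrow> real^'g^'g" and c g :: "real^'g \<Rightarrow> real^'g"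
    and lam :: real
    and v :: "nat \<Rightarrow> real^'g" and I :: "nat \<Rightarrow> 'g set" and d :: "nat \<Rightarrow> real^'g"
  assumes "symmetric_grid x"
    and "\<And>i. finite (Z i)" and "\<And>i. Z i \<noteq> {}" and "\<And>i. x i \<ge> 0 \<Longrightarrow> Z i = {0}"
    and "\<And>\<delta> i. \<delta> \<in> controls Z \<Longrightarrow> c \<delta> $ i > 0"
    and "row_decoupled x Z B c g"
    and "lam > 0"
    and "assumption_A0 x L Z B"
    and "assumption_A1 L Z B"
    and "assumption_A2 Z B"
    and "algorithm_run x L f Z B c g lam v I d"
  shows "bounded (range v)"
proof -
  note grid = assms(1) and dec = assms(6) and A0 = assms(8) and A1 = assms(9) and A2 = assms(10)
  note run = assms(11)[unfolded algorithm_run_def Let_def]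
  have finC: "finite (controls Z)" by (rule finite_controls) (rule assms(2))
  have neC: "controls Z \<noteq> {}" by (rule controls_nonempty) (rule assms(3))
  define P where "P = transition_rows x L Z B"
  have P_nonneg: "0 \<le> p j" if "p \<in> P i" for p i j
    using that transition_rows_substochastic(1)[OF grid A1 A2] by (simp add: P_def)
  obtain w e where w: "e > 0" "\<And>i. 0 < w i"
    "\<And>i p. p \<in> P i \<Longrightarrow> (\<Sum>j\<in>UNIV. p j * w j) \<le> w i - e"
  proof (rule strict_supersolution_exists[of P])
    show "finite (P i)" for i using finC by (simp add: P_def transition_rows_def)
    show "sum p UNIV \<le> 1" if "p \<in> P i" for p i
      using that transition_rows_substochastic(2)[OF grid A1 A2] by (simp add: P_def)
    show "\<exists>i\<in>R. \<forall>p\<in>P i. sum p UNIV < 1 \<or> (\<exists>j. j \<notin> R \<and> 0 < p j)" if "R \<noteq> {}" for R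
      unfolding P_def by (rule transition_rows_leak[OF grid neC dec A0 A1 A2 that])
  qed (use P_nonneg in blast)+
  define K where "K = (\<lambda>\<delta>. c \<delta>) ` controls Z \<union> (\<lambda>\<delta>. g (sym_op x *v \<delta>)) ` controls Z
    \<union> {\<chi> i. f $ i / (- L $ i $ i)}"
  have "bounded K" unfolding K_def by (intro finite_imp_bounded) (simp add: finC)
  then obtain C where C: "\<And>y. y \<in> K \<Longrightarrow> norm y \<le> C" by (auto simp: bounded_iff)
  have C': "\<bar>y $ i\<bar> \<le> C" if "y \<in> K" for y i
    using C[OF that] component_le_norm_cart[of y i] by linarith
  have affine: "\<bar>s\<bar> \<le> (\<Sum>j\<in>UNIV. p j * \<bar>u $ j\<bar>) + C"
    if "s = (\<Sum>j\<in>UNIV. p j * u $ j) + r" "\<bar>r\<bar> \<le> C" "p \<in> P i" for p u s r i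
    using that(1,2) abs_row_bound[of p u] P_nonneg[OF that(3)] by simp
  have d: "d k \<in> controls Z"
    "max_op Z B c (v k) $ i = (B (d k) *v v k) $ i - c (d k) $ i" for k i
    using best_impulse_attains[where u = "v k", OF assms(2,3) dec] run by simp_all
  have "I k \<subseteq> neg_points x" for k
    using run by (cases k) blast+
  then have I_neg: "x i < 0" if "i \<in> I k" for i k
    using that by (auto simp: neg_points_def)
  have step: "\<exists>p\<in>P i. \<exists>u\<in>{v k, v (Suc k)}. \<bar>v (Suc k) $ i\<bar> \<le> (\<Sum>j\<in>UNIV. p j * \<bar>u $ j\<bar>) + C"
    for k i
  proof -
    let ?u = "v (Suc k)"
    have sol: "solves_constrained L f Z B c (- (reflect x ` I k))
        (half_step x B g (I k) (d k) (v k)) ?u"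
      and I': "I (Suc k) = {i \<in> - (reflect x ` I k). (L *v ?u + f) $ i \<le>
         lam * (max_op Z B c ?u - ?u) $ i}"
      using run by blast+
    \<comment> \<open>The gain case uses the old iterate \<open>v k\<close>, the other two the new one.\<close>
    consider (pos) "i \<in> reflect x ` I k" | (neg) "i \<in> I (Suc k)"
      | (diff) "i \<notin> reflect x ` I k" "i \<notin> I (Suc k)" by blast
    then show ?thesis
    proof cases
      case pos
      define p where "p = (\<lambda>j. B (d k) $ reflect x i $ reflect x j)"
      have "0 < x i" using pos I_neg x_reflect[OF grid] by auto
      then have p: "p \<in> P i" using d(1) by (auto simp: P_def p_def transition_rows_def)
      have "?u $ i = gain_op x B g (d k) (v k) $ i"
        using sol pos by (auto simp: solves_constrained_def half_step_def)
      then have "?u $ i = (\<Sum>j\<in>UNIV. p j * v k $ j) + g (sym_op x *v d k) $ i"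
        unfolding gain_op_apply[OF grid] p_def .
      then have "\<bar>?u $ i\<bar> \<le> (\<Sum>j\<in>UNIV. p j * \<bar>v k $ j\<bar>) + C"
        by (rule affine[OF _ C' p]) (use d(1) in \<open>auto simp: K_def\<close>)
      then show ?thesis using p by blast
    next
      case neg
      define p where "p = (\<lambda>j. B (d (Suc k)) $ i $ j)"
      have p: "p \<in> P i" using d(1) I_neg[OF neg] by (auto simp: P_def p_def transition_rows_def)
      have mx: "max ((L *v ?u + f) $ i) ((max_op Z B c ?u - ?u) $ i) = 0"
        and le: "(L *v ?u + f) $ i \<le> lam * (max_op Z B c ?u - ?u) $ i"
        using sol neg I' by (auto simp: solves_constrained_def)
      \<comment> \<open>The two residuals are nonpositive and one of them vanishes; as \<open>lam > 0\<close>, the scaled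
          comparison decides which.\<close>
      have "(max_op Z B c ?u - ?u) $ i = 0"
      proof (rule ccontr)
        assume "(max_op Z B c ?u - ?u) $ i \<noteq> 0"
        then have "(max_op Z B c ?u - ?u) $ i < 0" "(L *v ?u + f) $ i = 0"
          using mx by (auto simp: max_def split: if_splits)
        then show False using le mult_pos_neg[OF assms(7)] by fastforce
      qed
      then have "?u $ i = (\<Sum>j\<in>UNIV. p j * ?u $ j) + - c (d (Suc k)) $ i"
        using d(2)[of "Suc k" i] by (simp add: p_def matrix_vector_mult_def)
      moreover have "\<bar>- c (d (Suc k)) $ i\<bar> \<le> C"
        using C'[of "c (d (Suc k))" i] d(1) by (auto simp: K_def)
      ultimately have "\<bar>?u $ i\<bar> \<le> (\<Sum>j\<in>UNIV. p j * \<bar>?u $ j\<bar>) + C"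
        using affine p by blast
      then show ?thesis using p by blast
    next
      case diff
      have p: "diffusion_row L i \<in> P i" by (simp add: P_def transition_rows_def)
      have mx: "max ((L *v ?u + f) $ i) ((max_op Z B c ?u - ?u) $ i) = 0"
        and gt: "lam * (max_op Z B c ?u - ?u) $ i < (L *v ?u + f) $ i"
        using sol diff I' by (auto simp: solves_constrained_def)
      have "(L *v ?u + f) $ i = 0"
      proof (rule ccontr)
        assume "(L *v ?u + f) $ i \<noteq> 0"
        then have "(L *v ?u + f) $ i < 0" "(max_op Z B c ?u - ?u) $ i = 0"
          using mx by (auto simp: max_def split: if_splits)
        then show False using gt by simp
      qed
      then have "?u $ i = (\<Sum>j\<in>UNIV. diffusion_row L i j * ?u $ j) + f $ i / (- L $ i $ i)"
        by (rule diffusion_row_solution[OF A1])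
      moreover have "\<bar>f $ i / (- L $ i $ i)\<bar> \<le> C"
        using C'[of "\<chi> i. f $ i / (- L $ i $ i)" i] by (simp add: K_def)
      ultimately have "\<bar>?u $ i\<bar> \<le> (\<Sum>j\<in>UNIV. diffusion_row L i j * \<bar>?u $ j\<bar>) + C"
        using affine p by blast
      then show ?thesis using p by blast
    qed
  qed
  show ?thesis
    by (rule bounded_of_strict_supersolution[of P e w v C]) (fact P_nonneg w step)+
qed

end
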